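(* For all integers $n\geq 0$ and $\ell\geq 1$, $\overline{R_{2\ell}^\ast}(2n+1)\equiv 0 \pmod{2}$.
   Context: An overpartition of $n$ is a partition of $n$ in which the first occurrence of each part size may optionally be overlined. For a positive integer $\ell$, $\overline{R_\ell^\ast}(n)$ denotes the number of overpartitions of $n$ in which no non-overlined part is divisible by $\ell$. Equivalently, with $f_k:=\prod_{i\geq 1}(1-q^{ki})$, one has $\sum_{n\geq 0}\overline{R_\ell^\ast}(n)q^n = \frac{f_2 f_\ell}{f_1^2}$. *)

theory Defs
  imports "HOL-Number_Theory.Cong" "HOL-Library.Multiset"
begin

definition partitions :: "nat \<Rightarrow> nat multiset set" where
  "partitions n = {M. 0 \<notin># M \<and> \<Sum>\<^sub># M = n}"

text \<open>
  An overpartition is a pair \<open>(M, S)\<close>: \<open>M\<close> is the underlying partition, and \<open>S\<close> is the set of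
  those part sizes whose first occurrence is overlined (so each size is overlined at most once).
\<close>

definition overpartitions :: "nat \<Rightarrow> (nat multiset \<times> nat set) set" where
  "overpartitions n = {(M, S). M \<in> partitions n \<and> S \<subseteq> set_mset M}"

fun non_overlined :: "nat multiset \<times> nat set \<Rightarrow> nat multiset" where
  "non_overlined (M, S) = M - mset_set S"

definition R_star :: "nat \<Rightarrow> nat \<Rightarrow> nat" where
  "R_star l n = card {P \<in> overpartitions n. \<forall>k \<in># non_overlined P. \<not> l dvd k}"

text \<open>Finiteness guarantees that \<open>card\<close> in \<^const>\<open>R_star\<close> is a genuine count.\<close>

lemma finite_partitions: "finite (partitions n)"
proof (rule finite_subset)
  show "partitions n \<subseteq> mset ` {xs. set xs \<subseteq> {..n} \<and> length xs \<le> n}"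
  proof
    fix M assume M: "M \<in> partitions n"
    obtain xs where xs: "M = mset xs" by (metis ex_mset)
    have s: "sum_list xs = n" and z: "0 \<notin> set xs"
      using M xs by (auto simp: partitions_def sum_mset_sum_list)
    have "length xs \<le> sum_list xs" using z
      by (induction xs) auto
    moreover have "set xs \<subseteq> {..n}" using s member_le_sum_list by auto
    ultimately show "M \<in> mset ` {xs. set xs \<subseteq> {..n} \<and> length xs \<le> n}"
      using s xs by auto
  qed
  show "finite (mset ` {xs. set xs \<subseteq> {..n} \<and> length xs \<le> n})"
    by (intro finite_imageI finite_lists_length_le) simp
qed

lemma finite_overpartitions: "finite (overpartitions n)"
proof -
  have "overpartitions n = (SIGMA M:partitions n. Pow (set_mset M))"
    by (auto simp: overpartitions_def)
  then show ?thesis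
    by (simp add: finite_partitions)
qed

end

theory Submission
  imports Defs
begin

text \<open>
  An odd number has an odd part in each of its partitions, and an odd part is never divisible
  by \<open>2 * l\<close>. Hence the overline on the smallest odd part size can be switched on or off freely,
  and this pairs the overpartitions in question.
\<close>

text \<open>The map \<open>f\<close> restricts to a bijection between the elements satisfying
  \<open>Q\<close> and the others, so both halves have the same size. A predicate that flips is a
  convenient form of having no fixed points: it names the halves directly and avoids counting
  orbits.\<close>

lemma even_card_switch:
  assumes "finite A"
    and closed: "\<And>x. x \<in> A \<Longrightarrow> f x \<in> A"
    and invol: "\<And>x. x \<in> A \<Longrightarrow> f (f x) = x"
    and switch: "\<And>x. x \<in> A \<Longrightarrow> Q (f x) \<longleftrightarrow> \<not> Q x"
  shows "even (card A)"
proof -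
  have "bij_betw f {x \<in> A. Q x} {x \<in> A. \<not> Q x}"
    by (rule bij_betw_byWitness[where f' = f]) (auto simp: closed invol switch)
  then have "card {x \<in> A. Q x} = card {x \<in> A. \<not> Q x}"
    by (rule bij_betw_same_card)
  moreover have "card A = card {x \<in> A. Q x} + card {x \<in> A. \<not> Q x}"
    using \<open>finite A\<close> by (subst card_Un_disjoint[symmetric]) (auto intro: arg_cong[where f = card])
  ultimately show ?thesis by simp
qed

lemma odd_sum_mset_ex_odd:
  fixes M :: "nat multiset"
  assumes "odd (\<Sum>\<^sub># M)"
  shows "\<exists>k \<in># M. odd k"
  using assms by (induction M) auto

text \<open>A canonical choice depending on \<open>M\<close> alone: changing the set of overlined
  sizes does not change which part is selected, so toggling twice acts at the same size.\<close>

definition least_odd_part :: "nat multiset \<Rightarrow> nat" where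
  "least_odd_part M = (LEAST k. k \<in># M \<and> odd k)"

lemma least_odd_part:
  assumes "odd (\<Sum>\<^sub># M)"
  shows "least_odd_part M \<in># M" "odd (least_odd_part M)"
  using LeastI_ex[of "\<lambda>k. k \<in># M \<and> odd k"] odd_sum_mset_ex_odd[OF assms]
  by (auto simp: least_odd_part_def)

fun toggle_overline :: "nat multiset \<times> nat set \<Rightarrow> nat multiset \<times> nat set" where
  "toggle_overline (M, S) = (M, sym_diff S {least_odd_part M})"

lemma toggle_overline_invol: "toggle_overline (toggle_overline P) = P"
  by (cases P) auto

text \<open>Since the sum is odd, the selected size really occurs in the partition, so it may be
  overlined.\<close>

lemma toggle_overline_overpartitions:
  assumes "odd n" "P \<in> overpartitions n"
  shows "toggle_overline P \<in> overpartitions n"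
  using assms least_odd_part(1) by (cases P) (auto simp: overpartitions_def partitions_def)

lemma non_overlined_toggle_overline:
  assumes "odd n" "(M, S) \<in> overpartitions n"
    and "k \<in># non_overlined (toggle_overline (M, S))" "k \<noteq> least_odd_part M"
  shows "k \<in># non_overlined (M, S)"
proof -
  \<comment> \<open>\<open>mset_set\<close> of an infinite set is empty, so finiteness is needed
    before counts can be read off from membership.\<close>
  have "finite S"
    using assms(2) finite_subset by (auto simp: overpartitions_def)
  then have "count (mset_set (sym_diff S {least_odd_part M})) k = count (mset_set S) k"
    using assms(4) by (auto simp: count_mset_set')
  then show ?thesis
    using assms(3) by (simp add: in_diff_count)
qed

lemma even_R_star:
  assumes "odd n" "even m"
  shows "even (R_star m n)"
  unfolding R_star_def
proof (rule even_card_switch[where f = toggle_overline and Q = "\<lambda>(M, S). least_odd_part M \<in> S"])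
  show "finite {P \<in> overpartitions n. \<forall>k \<in># non_overlined P. \<not> m dvd k}"
    by (simp add: finite_overpartitions)
next
  fix P assume P: "P \<in> {P \<in> overpartitions n. \<forall>k \<in># non_overlined P. \<not> m dvd k}"
  obtain M S where MS: "P = (M, S)" by (cases P)
  have "odd (least_odd_part M)"
    using P MS \<open>odd n\<close> by (intro least_odd_part) (auto simp: overpartitions_def partitions_def)
  then have "\<not> m dvd least_odd_part M"
    using \<open>even m\<close> by (meson dvd_trans)
  \<comment> \<open>The only non-overlined size that toggling can create is the least odd part,
    which the even number \<open>m\<close> does not divide; every other one was already present in
    \<open>P\<close>.\<close>
  then have "\<not> m dvd k" if "k \<in># non_overlined (toggle_overline P)" for k
    using non_overlined_toggle_overline[OF \<open>odd n\<close>, of M S k] P MS that by blast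
  then show "toggle_overline P \<in> {P \<in> overpartitions n. \<forall>k \<in># non_overlined P. \<not> m dvd k}"
    using toggle_overline_overpartitions[OF \<open>odd n\<close>] P by blast
  show "toggle_overline (toggle_overline P) = P"
    by (rule toggle_overline_invol)
  show "(case toggle_overline P of (M, S) \<Rightarrow> least_odd_part M \<in> S) \<longleftrightarrow>
    \<not> (case P of (M, S) \<Rightarrow> least_odd_part M \<in> S)"
    by (simp add: MS)
qed

theorem theorem1p3:
  fixes n l :: nat
  assumes "l \<ge> 1"
  shows "[R_star (2 * l) (2 * n + 1) = 0] (mod 2)"
  using even_R_star[of "2 * n + 1" "2 * l"] by (simp add: cong_0_iff)

end
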